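(* Consider a saturated full exponential family with natural statistic $Y$ in $\mathbb{R}^p$, polyhedral convex support $C_{\mathrm{sat}}$, and observed value $y\in C_{\mathrm{sat}}$, and a natural affine submodel $\theta=a+M\beta$, where $M$ is a $p\times q$ matrix, with natural statistic $M^TY$. Let $V_{\mathrm{sat}}\subset\mathbb{R}^p$ be a finite set with $T_{C_{\mathrm{sat}}}(y)=\mathrm{con}(\mathrm{pos}\,V_{\mathrm{sat}})$, let $V_{\mathrm{sub}}=\{M^Tv:v\in V_{\mathrm{sat}}\}$ and $L_{\mathrm{sub}}=\{w\in V_{\mathrm{sub}}:-w\in\mathrm{con}(\mathrm{pos}\,V_{\mathrm{sub}})\}$, and suppose $L_{\mathrm{sub}}\neq V_{\mathrm{sub}}$. Let $\delta\in\mathbb{R}^q$ be a generic direction of recession of the submodel and let $$H_{\mathrm{sat}}=\{w\in\mathbb{R}^p:\langle w-y,M\delta\rangle=0\}.$$ Define $$L_{\mathrm{sat}}=\{v\in V_{\mathrm{sat}}:M^Tv\in L_{\mathrm{sub}}\}.$$ Then the support of the limiting conditional model is $$C_{\mathrm{sat}}\cap H_{\mathrm{sat}}=C_{\mathrm{sat}}\cap(y+\mathrm{span}\,L_{\mathrm{sat}}).$$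
   Context: Full exponential family: there is a measurable space $\Omega$, a measurable map $Y:\Omega\to\mathbb{R}^p$ (the natural statistic), a probability measure $P_\psi$ on $\Omega$ labelled by some $\psi\in\mathbb{R}^p$, and a real number $c(\psi)$. The cumulant function is $c(\theta)=c(\psi)+\log E_\psi(e^{\langle Y,\theta-\psi\rangle})$, with $c(\theta)=\infty$ when the expectation is infinite; the natural parameter space is $\Theta=\{\theta\in\mathbb{R}^p:c(\theta)<\infty\}$; for $\theta\in\Theta$ the distribution with parameter $\theta$ has density $e^{\langle Y(\omega),\theta-\psi\rangle-c(\theta)+c(\psi)}$ with respect to $P_\psi$. Here $\langle\cdot,\cdot\rangle$ is the standard bilinear form. The convex support of a family is the smallest closed convex set containing its natural statistic with probability one under some (equivalently every) distribution in the family. Polyhedral means an intersection of finitely many closed half-spaces. Natural affine submodel: the distributions of the saturated family with $\theta=a+M\beta$, $a\in\mathbb{R}^p$ a known vector, $M$ a known $p\times q$ matrix; it is itself a full exponential family with natural statistic $M^TY$ and natural parameter $\beta$, and its convex support $C_{\mathrm{sub}}\subset\mathbb{R}^q$ is that of $M^TY$. With $V_{\mathrm{sub}}$ as in the claim, $T_{C_{\mathrm{sub}}}(M^Ty)=\mathrm{con}(\mathrm{pos}\,V_{\mathrm{sub}})$. For a convex set $C$ and $x\in C$: tangent cone $T_C(x)=\mathrm{cl}\{s(w-x):w\in C,\ s\ge 0\}$; normal cone $N_C(x)=\{\eta:\langle w-x,\eta\rangle\le 0\text{ for all }w\in C\}$. For a finite set $V$, $\mathrm{con}(\mathrm{pos}\,V)$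 is the set of all linear combinations of elements of $V$ with nonnegative coefficients. $\mathrm{span}\,B$ is the smallest vector subspace containing $B$. Generic direction of recession of the submodel: a vector $\delta\in\mathrm{rint}\,N_{C_{\mathrm{sub}}}(M^Ty)$, where $N_{C_{\mathrm{sub}}}(M^Ty)$ is not a vector subspace ($\mathrm{rint}$ is relative interior). Given $L_{\mathrm{sub}}\ne V_{\mathrm{sub}}$, equivalently: $\langle w,\delta\rangle=0$ for $w\in L_{\mathrm{sub}}$ and $\langle w,\delta\rangle<0$ for $w\in V_{\mathrm{sub}}\setminus L_{\mathrm{sub}}$. Limiting conditional model: the exponential family of conditional distributions, given the event $Y\in H_{\mathrm{sat}}$ (the same event as $M^TY\in H_{\mathrm{sub}}=\{w\in\mathbb{R}^q:\langle w-M^Ty,\delta\rangle=0\}$), of the distributions in the submodel; this event is assumed to have positive probability. The support of the limiting conditional model, expressed in terms of the saturated natural statistic $Y$, means the part of $C_{\mathrm{sat}}$ to which this conditioning event restricts $Y$, that is, $C_{\mathrm{sat}}\cap H_{\mathrm{sat}}$, so the assertion to be established is the displayed equality of sets. *)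

theory Defs
  imports "HOL-Probability.Probability"
begin

text \<open>
  A full exponential family is given by a reference probability measure \<open>P\<close>, its label \<open>\<psi>\<close>, a natural
  statistic \<open>Y\<close>, and the value \<open>c\<psi>\<close> of the cumulant function at \<open>\<psi>\<close>.
\<close>

text \<open>
  The integrand is positive and \<open>P\<close> is a probability measure, so the integral below is never 0 and
  the real logarithm is only applied to positive numbers.
\<close>

definition cumulant ::
    "'w measure \<Rightarrow> ('w \<Rightarrow> 'a::euclidean_space) \<Rightarrow> 'a \<Rightarrow> real \<Rightarrow> 'a \<Rightarrow> ereal" where
  "cumulant P Y \<psi> c\<psi> \<theta> =
     (let E = \<integral>\<^sup>+ \<omega>. ennreal (exp (Y \<omega> \<bullet> (\<theta> - \<psi>))) \<partial>P
      in if E = \<infinity> then \<infinity> else ereal (c\<psi> + ln (enn2real E)))"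

definition natural_parameter_space ::
    "'w measure \<Rightarrow> ('w \<Rightarrow> 'a::euclidean_space) \<Rightarrow> 'a \<Rightarrow> real \<Rightarrow> 'a set" where
  "natural_parameter_space P Y \<psi> c\<psi> = {\<theta>. cumulant P Y \<psi> c\<psi> \<theta> < \<infinity>}"

definition expfam_distribution ::
    "'w measure \<Rightarrow> ('w \<Rightarrow> 'a::euclidean_space) \<Rightarrow> 'a \<Rightarrow> real \<Rightarrow> 'a \<Rightarrow> 'w measure" where
  "expfam_distribution P Y \<psi> c\<psi> \<theta> =
     density P (\<lambda>\<omega>. ennreal (exp (Y \<omega> \<bullet> (\<theta> - \<psi>) - real_of_ereal (cumulant P Y \<psi> c\<psi> \<theta>) + c\<psi>)))"

definition expfam ::
    "'w measure \<Rightarrow> ('w \<Rightarrow> 'a::euclidean_space) \<Rightarrow> 'a \<Rightarrow> real \<Rightarrow> 'w measure set" where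
  "expfam P Y \<psi> c\<psi> = expfam_distribution P Y \<psi> c\<psi> ` natural_parameter_space P Y \<psi> c\<psi>"

definition affine_submodel ::
    "'w measure \<Rightarrow> ('w \<Rightarrow> real ^ 'p) \<Rightarrow> real ^ 'p \<Rightarrow> real \<Rightarrow> real ^ 'p \<Rightarrow> real ^ 'q ^ 'p \<Rightarrow> 'w measure set"
    where
  "affine_submodel P Y \<psi> c\<psi> a M =
     (\<lambda>\<beta>. expfam_distribution P Y \<psi> c\<psi> (a + M *v \<beta>)) `
       {\<beta>. a + M *v \<beta> \<in> natural_parameter_space P Y \<psi> c\<psi>}"

text \<open>
  Distributions in an exponential family are mutually absolutely continuous, so quantifying over some
  or over all members makes no difference. The intersection itself has probability one, because
  its complement is a countable union of complements of members of the intersected collection;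
  hence it is the smallest such set.
\<close>

definition convex_support :: "'w measure set \<Rightarrow> ('w \<Rightarrow> 'a::euclidean_space) \<Rightarrow> 'a set" where
  "convex_support \<Q> S = \<Inter> {K. closed K \<and> convex K \<and> (\<exists>Q\<in>\<Q>. AE \<omega> in Q. S \<omega> \<in> K)}"

definition tangent_cone :: "'a::euclidean_space set \<Rightarrow> 'a \<Rightarrow> 'a set" where
  "tangent_cone C x = closure {s *\<^sub>R (w - x) | s w. w \<in> C \<and> 0 \<le> s}"

definition normal_cone :: "'a::euclidean_space set \<Rightarrow> 'a \<Rightarrow> 'a set" where
  "normal_cone C x = {\<eta>. \<forall>w\<in>C. (w - x) \<bullet> \<eta> \<le> 0}"

text \<open>Intended for finite \<open>V\<close> only; \<open>con_pos {} = {0}\<close>.\<close>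

definition con_pos :: "'a::real_vector set \<Rightarrow> 'a set" where
  "con_pos V = {(\<Sum>v\<in>V. k v *\<^sub>R v) | k. \<forall>v\<in>V. 0 \<le> k v}"

definition generic_direction_of_recession :: "'a::euclidean_space set \<Rightarrow> 'a \<Rightarrow> 'a \<Rightarrow> bool" where
  "generic_direction_of_recession C x \<delta> \<longleftrightarrow>
     \<not> subspace (normal_cone C x) \<and> \<delta> \<in> rel_interior (normal_cone C x)"

end

theory Submission
  imports Defs
begin

text \<open>
  The key is a computation of polars: the normal cone of \<open>C_sub\<close> at \<open>M\<^sup>T y\<close> is the polar cone
  \<open>{\<eta>. \<forall>w\<in>V_sub. w \<bullet> \<eta> \<le> 0}\<close> of the generators \<open>V_sub\<close> (\<open>normal_cone_submodel\<close>). Tangent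
  directions of \<open>C_sat\<close> at \<open>y\<close> are nonnegative combinations of \<open>V_sat\<close>, so \<open>\<eta>\<close> is in this polar
  iff \<open>M \<eta>\<close> is normal to \<open>C_sat\<close> at \<open>y\<close>. To compare with \<open>C_sub\<close>, two facts about supports are
  needed. A closed convex set that contains \<open>M\<^sup>T Y\<close> almost surely has a closed convex preimage under
  \<open>M\<^sup>T\<close> that contains \<open>Y\<close> almost surely; hence \<open>M\<^sup>T\<close> maps \<open>C_sat\<close> into \<open>C_sub\<close>. Conversely \<open>Y\<close> lies
  in \<open>C_sat\<close> almost surely, so every half-space that contains \<open>M\<^sup>T C_sat\<close> contains \<open>C_sub\<close>. Membership
  of \<open>\<eta>\<close> in a normal cone only says that one half-space contains the set, so the normal cones of \<open>C_sub\<close>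
  and \<open>M\<^sup>T C_sat\<close> at \<open>M\<^sup>T y\<close> coincide.

  Next, a relative interior point \<open>\<delta>\<close> of a polar cone is strictly negative on each generator \<open>w\<close>
  for which \<open>-w\<close> is not in the cone spanned by the generators (\<open>rel_interior_polar_inner_neg\<close>): Farkas' lemma gives some
  \<open>\<eta>\<close> in the polar with \<open>w \<bullet> \<eta> < 0\<close>, and the segment from \<open>\<eta>\<close> to \<open>\<delta>\<close> can be prolonged beyond \<open>\<delta>\<close>
  inside the polar, which rules out \<open>w \<bullet> \<delta> = 0\<close>. On \<open>L_sub\<close> the inner product with \<open>\<delta>\<close> is zero,
  because both \<open>w\<close> and \<open>-w\<close> are in the cone.

  For \<open>x \<in> C_sat\<close>, write \<open>x - y\<close> as a nonnegative combination of \<open>V_sat\<close>. If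
  \<open>x \<in> H_sat\<close>, the inner product with \<open>M \<delta>\<close> is a sum of nonpositive terms equal to zero, so every
  generator outside \<open>L_sat\<close> has coefficient zero. The reverse inclusion holds because \<open>M \<delta>\<close> is orthogonal
  to \<open>L_sat\<close>.
\<close>

section \<open>Finitely generated cones and their polars\<close>

lemma con_pos_eq_convex_cone_hull:
  fixes V :: "'a::real_vector set"
  assumes "finite V"
  shows "con_pos V = convex_cone hull V"
proof
  show "con_pos V \<subseteq> convex_cone hull V"
  proof
    fix x assume "x \<in> con_pos V"
    then obtain k where k: "\<forall>v\<in>V. 0 \<le> k v" and x: "x = (\<Sum>v\<in>V. k v *\<^sub>R v)"
      by (auto simp: con_pos_def)
    have "(\<Sum>v\<in>W. k v *\<^sub>R v) \<in> convex_cone hull V" if "W \<subseteq> V" for W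
      using finite_subset[OF that assms] that
    proof (induction W rule: finite_induct)
      case empty
      then show ?case by (simp add: convex_cone_hull_contains_0)
    next
      case (insert v W)
      then show ?case
        using k by (simp add: convex_cone_hull_add convex_cone_hull_mul hull_inc)
    qed
    then show "x \<in> convex_cone hull V" using x by blast
  qed
  show "convex_cone hull V \<subseteq> con_pos V"
  proof (rule hull_minimal)
    show "V \<subseteq> con_pos V"
    proof
      fix w assume "w \<in> V"
      then have "(\<Sum>v\<in>V. (if v = w then 1 else 0) *\<^sub>R v) = w"
        using assms by (simp add: if_distrib[of "\<lambda>c. c *\<^sub>R _"] cong: if_cong)
      then show "w \<in> con_pos V"
        unfolding con_pos_def by (auto intro!: exI[of _ "\<lambda>v. if v = w then 1 else 0"])
    qed
    have "0 \<in> con_pos V"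
      unfolding con_pos_def by (auto intro!: exI[of _ "\<lambda>_. 0"])
    moreover have "x + z \<in> con_pos V" if xz: "x \<in> con_pos V" "z \<in> con_pos V" for x z
    proof -
      obtain k l where "\<forall>v\<in>V. 0 \<le> k v" "x = (\<Sum>v\<in>V. k v *\<^sub>R v)"
          "\<forall>v\<in>V. 0 \<le> l v" "z = (\<Sum>v\<in>V. l v *\<^sub>R v)"
        using xz by (auto simp: con_pos_def)
      then have "x + z = (\<Sum>v\<in>V. (k v + l v) *\<^sub>R v) \<and> (\<forall>v\<in>V. 0 \<le> k v + l v)"
        by (simp add: scaleR_add_left sum.distrib)
      then show ?thesis
        unfolding con_pos_def by (intro CollectI exI[of _ "\<lambda>v. k v + l v"])
    qed
    moreover have "c *\<^sub>R x \<in> con_pos V" if xc: "x \<in> con_pos V" "0 \<le> c" for x c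
    proof -
      obtain k where "\<forall>v\<in>V. 0 \<le> k v" "x = (\<Sum>v\<in>V. k v *\<^sub>R v)"
        using xc(1) by (auto simp: con_pos_def)
      then have "c *\<^sub>R x = (\<Sum>v\<in>V. (c * k v) *\<^sub>R v) \<and> (\<forall>v\<in>V. 0 \<le> c * k v)"
        using xc(2) by (simp add: scaleR_sum_right)
      then show ?thesis
        unfolding con_pos_def by (intro CollectI exI[of _ "\<lambda>v. c * k v"])
    qed
    ultimately show "convex_cone (con_pos V)"
      by (auto simp: convex_cone_iff)
  qed
qed

lemma con_pos_inner_le_0_iff:
  fixes V :: "'a::real_inner set"
  assumes "finite V"
  shows "(\<forall>u\<in>con_pos V. u \<bullet> \<eta> \<le> 0) \<longleftrightarrow> (\<forall>v\<in>V. v \<bullet> \<eta> \<le> 0)"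
proof
  assume "\<forall>u\<in>con_pos V. u \<bullet> \<eta> \<le> 0"
  then show "\<forall>v\<in>V. v \<bullet> \<eta> \<le> 0"
    using assms by (simp add: con_pos_eq_convex_cone_hull hull_inc)
next
  assume "\<forall>v\<in>V. v \<bullet> \<eta> \<le> 0"
  then show "\<forall>u\<in>con_pos V. u \<bullet> \<eta> \<le> 0"
    by (auto simp: con_pos_def inner_sum_left intro!: sum_nonpos mult_nonneg_nonpos)
qed

text \<open>
  Farkas' lemma: a finitely generated cone is closed, hence any point outside it is strictly separated
  from it, and by homogeneity the separating hyperplane may be taken through the origin.
\<close>

lemma con_pos_separate:
  fixes V :: "'a::euclidean_space set"
  assumes "finite V" "z \<notin> con_pos V"
  obtains \<eta> where "\<forall>v\<in>V. v \<bullet> \<eta> \<le> 0" "0 < z \<bullet> \<eta>"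
proof -
  let ?K = "convex_cone hull V"
  have "z \<notin> ?K" using assms by (simp add: con_pos_eq_convex_cone_hull)
  then obtain h b where hz: "h \<bullet> z < b" and hK: "\<forall>x\<in>?K. b < h \<bullet> x"
    using separating_hyperplane_closed_point[OF convex_convex_cone_hull closed_convex_cone_hull]
      assms(1) by blast
  have "b < 0" using hK convex_cone_hull_contains_0[of V] by fastforce
  have "0 \<le> h \<bullet> v" if "v \<in> V" for v
  proof (rule ccontr)
    assume neg: "\<not> 0 \<le> h \<bullet> v"
    \<comment> \<open>Rescaled to touch the separating hyperplane, \<open>v\<close> stays in the cone.\<close>
    have "(b / (h \<bullet> v)) *\<^sub>R v \<in> ?K"
      using that neg \<open>b < 0\<close> by (intro convex_cone_hull_mul hull_inc) (auto simp: zero_le_divide_iff)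
    then show False using hK neg by fastforce
  qed
  then show thesis
    using that[of "- h"] hz \<open>b < 0\<close> by (simp add: inner_commute)
qed

text \<open>
  This makes genericity usable: \<open>\<delta>\<close> can be pushed slightly away from any \<open>\<eta>\<close> of the polar without
  leaving the polar. If \<open>w \<bullet> \<delta>\<close> vanished, pushing away from some \<open>\<eta>\<close> with \<open>w \<bullet> \<eta> < 0\<close> would produce a point
  of the polar with positive inner product with \<open>w\<close>.
\<close>

lemma rel_interior_polar_inner_neg:
  fixes V :: "'a::euclidean_space set"
  assumes "finite V" "\<delta> \<in> rel_interior {\<eta>. \<forall>v\<in>V. v \<bullet> \<eta> \<le> 0}"
    and "w \<in> V" "- w \<notin> con_pos V"
  shows "w \<bullet> \<delta> < 0"
proof -
  let ?N = "{\<eta>. \<forall>v\<in>V. v \<bullet> \<eta> \<le> 0}"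
  have "?N = (\<Inter>v\<in>V. {\<eta>. v \<bullet> \<eta> \<le> 0})" by auto
  then have "convex ?N" by (simp add: convex_INT convex_halfspace_le)
  obtain \<eta> where \<eta>: "\<eta> \<in> ?N" "w \<bullet> \<eta> < 0"
    using con_pos_separate[OF assms(1,4)] by auto
  obtain e where e: "1 < e" "(1 - e) *\<^sub>R \<eta> + e *\<^sub>R \<delta> \<in> ?N"
    using convex_rel_interior_if2[OF \<open>convex ?N\<close> assms(2)] hull_inc[OF \<eta>(1), of affine] by blast
  have "(1 - e) * (w \<bullet> \<eta>) + e * (w \<bullet> \<delta>) \<le> 0"
    using e(2) assms(3) by (auto simp: inner_add_right)
  moreover have "0 < (1 - e) * (w \<bullet> \<eta>)"
    using e(1) \<eta>(2) by (simp add: mult_neg_neg)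
  ultimately have "e * (w \<bullet> \<delta>) < 0" by linarith
  then show ?thesis using e(1) by (simp add: mult_less_0_iff)
qed

section \<open>Normal and tangent cones\<close>

lemma diff_in_tangent_cone: "w \<in> C \<Longrightarrow> w - x \<in> tangent_cone C x"
  unfolding tangent_cone_def
  by (intro subsetD[OF closure_subset] CollectI exI[of _ 1] exI[of _ w]) auto

lemma normal_cone_eq_polar_tangent_cone:
  "normal_cone C x = {\<eta>. \<forall>u\<in>tangent_cone C x. u \<bullet> \<eta> \<le> 0}"
proof (intro equalityI subsetI CollectI)
  fix \<eta> assume \<eta>: "\<eta> \<in> normal_cone C x"
  have "tangent_cone C x \<subseteq> {u. \<eta> \<bullet> u \<le> 0}"
    unfolding tangent_cone_def
  proof (rule closure_minimal)
    show "{s *\<^sub>R (w - x) |s w. w \<in> C \<and> 0 \<le> s} \<subseteq> {u. \<eta> \<bullet> u \<le> 0}"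
      using \<eta> by (auto simp: normal_cone_def inner_commute[of \<eta>] intro!: mult_nonneg_nonpos)
  qed (rule closed_halfspace_le)
  then show "\<forall>u\<in>tangent_cone C x. u \<bullet> \<eta> \<le> 0" by (auto simp: inner_commute)
qed (auto simp: normal_cone_def dest: diff_in_tangent_cone)

section \<open>Convex supports in exponential families\<close>

lemma AE_expfam_distribution_iff:
  assumes "Y \<in> borel_measurable P"
  shows "(AE \<omega> in expfam_distribution P Y \<psi> c\<psi> \<theta>. A \<omega>) \<longleftrightarrow> (AE \<omega> in P. A \<omega>)"
  unfolding expfam_distribution_def using assms by (subst AE_density) auto

text \<open>
  The natural statistic lies in the convex support almost surely. The intersection that defines the
  support may be uncountable, but by the Lindelof property countably many of the sets already have the
  same intersection.
\<close>

lemma AE_in_convex_support: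
  assumes "Y \<in> borel_measurable P"
  shows "AE \<omega> in P. Y \<omega> \<in> convex_support (expfam P Y \<psi> c\<psi>) Y"
proof -
  let ?\<K> = "{K. closed K \<and> convex K \<and> (\<exists>Q\<in>expfam P Y \<psi> c\<psi>. AE \<omega> in Q. Y \<omega> \<in> K)}"
  obtain \<F> where \<F>: "\<F> \<subseteq> uminus ` ?\<K>" "countable \<F>" "\<Union>\<F> = \<Union>(uminus ` ?\<K>)"
    by (rule Lindelof[of "uminus ` ?\<K>"]) auto
  have "AE \<omega> in P. Y \<omega> \<notin> U" if "U \<in> \<F>" for U
  proof -
    have "U \<in> uminus ` ?\<K>" using that \<F>(1) by (rule subsetD[rotated])
    then obtain K where K: "U = - K" "K \<in> ?\<K>" by (rule imageE)
    then obtain Q where "Q \<in> expfam P Y \<psi> c\<psi>" "AE \<omega> in Q. Y \<omega> \<in> K" by blast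
    then show ?thesis
      unfolding expfam_def using AE_expfam_distribution_iff[OF assms] K(1) by auto
  qed
  then have "AE \<omega> in P. \<forall>U\<in>\<F>. Y \<omega> \<notin> U"
    by (simp add: AE_ball_countable \<F>(2))
  then have "AE \<omega> in P. Y \<omega> \<notin> \<Union>\<F>" by simp
  then show ?thesis
    unfolding \<F>(3) convex_support_def by eventually_elim auto
qed

text \<open>
  An empty submodel would have convex support \<open>UNIV\<close>, the intersection of no sets at all, whose normal
  cones are trivial.
\<close>

lemma affine_submodel_nonempty:
  assumes "\<not> subspace (normal_cone (convex_support (affine_submodel P Y \<psi> c\<psi> a M) S) x)"
  shows "affine_submodel P Y \<psi> c\<psi> a M \<noteq> {}"
proof
  assume "affine_submodel P Y \<psi> c\<psi> a M = {}"
  then have "convex_support (affine_submodel P Y \<psi> c\<psi> a M) S = UNIV"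
    by (simp add: convex_support_def)
  moreover have "normal_cone UNIV x = {0}"
  proof -
    have "\<eta> = 0" if "\<eta> \<in> normal_cone UNIV x" for \<eta>
    proof -
      have "((x + \<eta>) - x) \<bullet> \<eta> \<le> 0" using that unfolding normal_cone_def by blast
      then show ?thesis by (simp flip: not_less)
    qed
    then show ?thesis by (auto simp: normal_cone_def)
  qed
  ultimately show False using assms by simp
qed

lemma affine_submodel_subset_expfam: "affine_submodel P Y \<psi> c\<psi> a M \<subseteq> expfam P Y \<psi> c\<psi>"
  by (auto simp: affine_submodel_def expfam_def)

lemma transpose_mult_in_convex_support_submodel:
  fixes M :: "real ^ 'q ^ 'p"
  assumes x: "x \<in> convex_support (expfam P Y \<psi> c\<psi>) Y"
  shows "transpose M *v x
    \<in> convex_support (affine_submodel P Y \<psi> c\<psi> a M) (\<lambda>\<omega>. transpose M *v Y \<omega>)"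
  unfolding convex_support_def
proof (intro InterI, clarify)
  fix K Q
  assume K: "closed K" "convex K" and Q: "Q \<in> affine_submodel P Y \<psi> c\<psi> a M"
    and AE: "AE \<omega> in Q. transpose M *v Y \<omega> \<in> K"
  let ?K = "(\<lambda>u. transpose M *v u) -` K"
  have "linear ((*v) (transpose M))"
    by (rule matrix_vector_mul_linear)
  then have "closed ?K" "convex ?K"
    using K by (auto intro!: continuous_closed_vimage linear_continuous_at
        convex_linear_vimage simp: linear_conv_bounded_linear simp del: transpose_matrix_vector)
  moreover have "AE \<omega> in Q. Y \<omega> \<in> ?K" using AE by simp
  moreover have "Q \<in> expfam P Y \<psi> c\<psi>" using Q affine_submodel_subset_expfam by blast
  ultimately have "x \<in> ?K" using x unfolding convex_support_def by blast
  then show "transpose M *v x \<in> K" by simp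
qed

lemma convex_support_submodel_subset_halfspace:
  fixes M :: "real ^ 'q ^ 'p"
  assumes Y: "Y \<in> borel_measurable P"
    and ne: "affine_submodel P Y \<psi> c\<psi> a M \<noteq> {}"
    and le: "\<And>x. x \<in> convex_support (expfam P Y \<psi> c\<psi>) Y \<Longrightarrow> (transpose M *v x) \<bullet> \<eta> \<le> b"
  shows "convex_support (affine_submodel P Y \<psi> c\<psi> a M) (\<lambda>\<omega>. transpose M *v Y \<omega>)
    \<subseteq> {u. u \<bullet> \<eta> \<le> b}"
proof -
  obtain Q where Q: "Q \<in> affine_submodel P Y \<psi> c\<psi> a M" using ne by blast
  have "AE \<omega> in P. transpose M *v Y \<omega> \<in> {u. u \<bullet> \<eta> \<le> b}"
    using AE_in_convex_support[OF Y] by eventually_elim (use le in blast)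
  then have "AE \<omega> in Q. transpose M *v Y \<omega> \<in> {u. u \<bullet> \<eta> \<le> b}"
    using Q AE_expfam_distribution_iff[OF Y] by (auto simp: affine_submodel_def)
  moreover have "closed {u. u \<bullet> \<eta> \<le> b}" "convex {u. u \<bullet> \<eta> \<le> b}"
    using closed_halfspace_le[of \<eta> b] convex_halfspace_le[of \<eta> b] by (simp_all add: inner_commute)
  ultimately show ?thesis
    unfolding convex_support_def using Q by blast
qed

text \<open>
  Both sides say that \<open>M \<eta>\<close> is normal to the saturated convex support at \<open>y\<close>, since
  \<open>M\<^sup>T u \<bullet> \<eta> = u \<bullet> M \<eta>\<close>.
\<close>

lemma normal_cone_submodel:
  fixes M :: "real ^ 'q ^ 'p"
  assumes Y: "Y \<in> borel_measurable P"
    and ne: "affine_submodel P Y \<psi> c\<psi> a M \<noteq> {}"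
    and V: "finite V" "tangent_cone (convex_support (expfam P Y \<psi> c\<psi>) Y) y = con_pos V"
  shows "normal_cone (convex_support (affine_submodel P Y \<psi> c\<psi> a M) (\<lambda>\<omega>. transpose M *v Y \<omega>))
      (transpose M *v y)
    = {\<eta>. \<forall>w\<in>(\<lambda>v. transpose M *v v) ` V. w \<bullet> \<eta> \<le> 0}"
proof -
  let ?C = "convex_support (expfam P Y \<psi> c\<psi>) Y"
  let ?D = "convex_support (affine_submodel P Y \<psi> c\<psi> a M) (\<lambda>\<omega>. transpose M *v Y \<omega>)"
  have normal: "M *v \<eta> \<in> normal_cone ?C y \<longleftrightarrow> (\<forall>v\<in>V. v \<bullet> (M *v \<eta>) \<le> 0)" for \<eta>
    by (simp add: normal_cone_eq_polar_tangent_cone V con_pos_inner_le_0_iff)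
  have "\<eta> \<in> normal_cone ?D (transpose M *v y) \<longleftrightarrow> M *v \<eta> \<in> normal_cone ?C y" for \<eta>
  proof
    assume "\<eta> \<in> normal_cone ?D (transpose M *v y)"
    then have "(transpose M *v x - transpose M *v y) \<bullet> \<eta> \<le> 0" if "x \<in> ?C" for x
      using transpose_mult_in_convex_support_submodel[OF that] unfolding normal_cone_def by blast
    then show "M *v \<eta> \<in> normal_cone ?C y"
      by (simp add: normal_cone_def inner_diff_left dot_lmul_matrix)
  next
    assume "M *v \<eta> \<in> normal_cone ?C y"
    then have "?D \<subseteq> {u. u \<bullet> \<eta> \<le> (transpose M *v y) \<bullet> \<eta>}"
      by (intro convex_support_submodel_subset_halfspace[OF Y ne])
        (simp add: normal_cone_def inner_diff_left dot_lmul_matrix)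
    then show "\<eta> \<in> normal_cone ?D (transpose M *v y)"
      by (auto simp: normal_cone_def inner_diff_left)
  qed
  then show ?thesis
    by (auto simp: normal dot_lmul_matrix)
qed

section \<open>The support of the limiting conditional model\<close>

theorem theorem11:
  fixes P :: "'w measure"
    and Y :: "'w \<Rightarrow> real ^ 'p"
    and \<psi> a y :: "real ^ 'p"
    and c\<psi> :: real
    and M :: "real ^ 'q ^ 'p"
    and \<delta> :: "real ^ 'q"
    and C_sat V_sat L_sat H_sat :: "(real ^ 'p) set"
    and C_sub V_sub L_sub :: "(real ^ 'q) set"
  assumes "prob_space P"
    and "Y \<in> borel_measurable P"
    and "C_sat = convex_support (expfam P Y \<psi> c\<psi>) Y"
    and "polyhedron C_sat"
    and "y \<in> C_sat"
    and "C_sub = convex_support (affine_submodel P Y \<psi> c\<psi> a M) (\<lambda>\<omega>. transpose M *v Y \<omega>)"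
    and "finite V_sat"
    and "tangent_cone C_sat y = con_pos V_sat"
    and "V_sub = {transpose M *v v | v. v \<in> V_sat}"
    and "L_sub = {w \<in> V_sub. - w \<in> con_pos V_sub}"
    and "L_sub \<noteq> V_sub"
    and "generic_direction_of_recession C_sub (transpose M *v y) \<delta>"
    and "H_sat = {w. (w - y) \<bullet> (M *v \<delta>) = 0}"
    and "\<forall>Q \<in> affine_submodel P Y \<psi> c\<psi> a M. measure Q {\<omega> \<in> space Q. Y \<omega> \<in> H_sat} > 0"
    and "L_sat = {v \<in> V_sat. transpose M *v v \<in> L_sub}"
  shows "C_sat \<inter> H_sat = C_sat \<inter> {y + u | u. u \<in> span L_sat}"
proof -
  have V_sub: "V_sub = (\<lambda>v. transpose M *v v) ` V_sat" unfolding assms(9) by (rule Setcompr_eq_image)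
  then have fin: "finite V_sub" using assms(7) by simp
  have "affine_submodel P Y \<psi> c\<psi> a M \<noteq> {}"
    using assms(12) affine_submodel_nonempty
    unfolding assms(6) generic_direction_of_recession_def by blast
  then have "normal_cone C_sub (transpose M *v y) = {\<eta>. \<forall>w\<in>V_sub. w \<bullet> \<eta> \<le> 0}"
    unfolding assms(6) V_sub
    using normal_cone_submodel[OF assms(2) _ assms(7)] assms(3,8) by blast
  then have \<delta>: "\<delta> \<in> rel_interior {\<eta>. \<forall>w\<in>V_sub. w \<bullet> \<eta> \<le> 0}"
    using assms(12) by (simp add: generic_direction_of_recession_def)
  then have \<delta>_le: "\<forall>w\<in>V_sub. w \<bullet> \<delta> \<le> 0" using rel_interior_subset by blast
  have \<delta>_eq: "w \<bullet> \<delta> = 0" if "w \<in> L_sub" for w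
  proof -
    have "w \<in> V_sub" "- w \<in> con_pos V_sub" using that assms(10) by auto
    then have "w \<bullet> \<delta> \<le> 0" "(- w) \<bullet> \<delta> \<le> 0"
      using \<delta>_le con_pos_inner_le_0_iff[OF fin] by blast+
    then show ?thesis by simp
  qed
  have M\<delta>: "v \<bullet> (M *v \<delta>) = (transpose M *v v) \<bullet> \<delta>" for v
    by (simp add: dot_lmul_matrix)
  have M\<delta>_le: "v \<bullet> (M *v \<delta>) \<le> 0" if "v \<in> V_sat" for v
    using that \<delta>_le V_sub M\<delta> by auto
  have M\<delta>_less: "v \<bullet> (M *v \<delta>) < 0" if "v \<in> V_sat - L_sat" for v
    unfolding M\<delta> using that assms(10,15) V_sub
    by (intro rel_interior_polar_inner_neg[OF fin \<delta>]) auto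
  have "x - y \<in> span L_sat" if "x \<in> C_sat" "x \<in> H_sat" for x
  proof -
    have "x - y \<in> con_pos V_sat" using diff_in_tangent_cone that(1) assms(8) by blast
    then obtain k where k: "\<forall>v\<in>V_sat. 0 \<le> k v" and xy: "x - y = (\<Sum>v\<in>V_sat. k v *\<^sub>R v)"
      by (auto simp: con_pos_def)
    have "(\<Sum>v\<in>V_sat. k v * (v \<bullet> (M *v \<delta>))) = 0"
      using that(2) assms(13) by (simp add: xy inner_sum_left)
    then have zero: "\<forall>v\<in>V_sat. k v * (v \<bullet> (M *v \<delta>)) = 0"
      using k M\<delta>_le sum_nonneg_eq_0_iff[OF assms(7), of "\<lambda>v. - (k v * (v \<bullet> (M *v \<delta>)))"]
      by (simp add: sum_negf mult_nonneg_nonpos)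
    have "k v *\<^sub>R v \<in> span L_sat" if "v \<in> V_sat" for v
    proof (cases "v \<in> L_sat")
      case True
      then show ?thesis by (simp add: span_base span_scale)
    next
      case False
      then have "k v = 0" using zero M\<delta>_less[of v] that by auto
      then show ?thesis by (simp add: span_zero)
    qed
    then show ?thesis unfolding xy by (rule span_sum)
  qed
  moreover have "u \<bullet> (M *v \<delta>) = 0" if "u \<in> span L_sat" for u
    using that
  proof (rule span_induct)
    show "subspace {u. u \<bullet> (M *v \<delta>) = 0}"
      by (auto simp: subspace_def inner_add_left)
  qed (use assms(15) \<delta>_eq M\<delta> in auto)
  ultimately show ?thesis
    using assms(13) by (auto intro!: exI[of _ "_ - y"])
qed

end
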